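(* Let $X$ be a proper geodesic metric space, let $\rho$ be a sublinear function, and let $L\ge1$, $A\ge0$. Let $Z\subset X$ be $\rho$-contracting and let $\beta\colon[0,\infty)\to X$ be a continuous $(L,A)$-quasi-geodesic ray with $d(\beta_0,Z)\le\kappa(\rho,L,A)$. There are two possibilities: (1) The set $\{t\mid d(\beta_t,Z)\le\kappa(\rho,L,A)\}$ is unbounded and $\beta$ is contained in the $\kappa'(\rho,L,A)$-neighborhood of $Z$. (2) There exists a last time $T_0$ such that $d(\beta_{T_0},Z)=\kappa(\rho,L,A)$, and for all $t$: $$d(\beta_t,Z)\ge\frac{1}{2L}(t-T_0)-2(A+\kappa(\rho,L,A)).$$
   Context: A function $\rho\colon[0,\infty)\to\mathbb{R}$ is sublinear if it is non-decreasing, eventually non-negative, and $\lim_{r\to\infty}\rho(r)/r=0$. For a closed subset $Z\subset X$ let $\pi_Z(x):=\{z\in Z\mid d(x,z)=d(x,Z)\}$. $Z$ (closed) is $\rho$-contracting if for all $x,y\in X$: $d(x,y)\le d(x,Z)$ implies $\operatorname{diam}(\pi_Z(x)\cup\pi_Z(y))\le\rho(d(x,Z))$. An $(L,A)$-quasi-geodesic is a map $\gamma$ from an interval to $X$ with $\frac1L|s-t|-A\le d(\gamma_s,\gamma_t)\le L|s-t|+A$ for all $s,t$, where $\gamma_t:=\gamma(t)$. Define $\kappa(\rho,L,A):=\max\{3A,\,3L^2,\,1+\inf\{R>0\mid\forall r\ge R,\ 3L^2\rho(r)\le r\}\}$ and $\kappa'(\rho,L,A):=(L^2+2)(2\kappa(\rho,L,A)+A)$.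 The $r$-neighborhood of $Z$ is $\{x\in X\mid\exists z\in Z,\ d(x,z)<r\}$. *)

theory Defs
  imports "HOL-Analysis.Analysis"
begin

definition proper_space :: "'a::metric_space itself \<Rightarrow> bool" where
  "proper_space _ \<longleftrightarrow> (\<forall>(x::'a) r. compact (cball x r))"

definition geodesic_space :: "'a::metric_space itself \<Rightarrow> bool" where
  "geodesic_space _ \<longleftrightarrow> (\<forall>(x::'a) y. \<exists>g::real \<Rightarrow> 'a.
     g 0 = x \<and> g (dist x y) = y \<and>
     (\<forall>s\<in>{0..dist x y}. \<forall>t\<in>{0..dist x y}. dist (g s) (g t) = \<bar>s - t\<bar>))"

(* Functions on [0, \<infinity>) are total functions on the reals whose values at
   negative arguments are never used. *)
definition sublinear :: "(real \<Rightarrow> real) \<Rightarrow> bool" where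
  "sublinear \<rho> \<longleftrightarrow> mono_on {0..} \<rho> \<and> (\<forall>\<^sub>F r in at_top. 0 \<le> \<rho> r) \<and>
     ((\<lambda>r. \<rho> r / r) \<longlongrightarrow> 0) at_top"

definition closest_points :: "'a::metric_space set \<Rightarrow> 'a \<Rightarrow> 'a set" where
  "closest_points Z x = {z \<in> Z. dist x z = infdist x Z}"

(* The union below is bounded, being contained in the union of the cballs about
   x and y with radii infdist x Z and infdist y Z, so diameter is its true diameter.
   Intended for nonempty Z: infdist x {} is 0, not infinity. *)
definition contracting :: "(real \<Rightarrow> real) \<Rightarrow> 'a::metric_space set \<Rightarrow> bool" where
  "contracting \<rho> Z \<longleftrightarrow> closed Z \<and>
     (\<forall>x y. dist x y \<le> infdist x Z \<longrightarrow>
        diameter (closest_points Z x \<union> closest_points Z y) \<le> \<rho> (infdist x Z))"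

definition quasi_geodesic_on ::
    "real set \<Rightarrow> real \<Rightarrow> real \<Rightarrow> (real \<Rightarrow> 'a::metric_space) \<Rightarrow> bool" where
  "quasi_geodesic_on I L A \<gamma> \<longleftrightarrow> is_interval I \<and>
     (\<forall>s\<in>I. \<forall>t\<in>I. 1 / L * \<bar>s - t\<bar> - A \<le> dist (\<gamma> s) (\<gamma> t) \<and>
                 dist (\<gamma> s) (\<gamma> t) \<le> L * \<bar>s - t\<bar> + A)"

(* For sublinear rho the set under Inf is nonempty and bounded below,
   so Inf is the true infimum. *)
definition kappa :: "(real \<Rightarrow> real) \<Rightarrow> real \<Rightarrow> real \<Rightarrow> real" where
  "kappa \<rho> L A =
     Max {3 * A, 3 * L\<^sup>2, 1 + Inf {R. 0 < R \<and> (\<forall>r\<ge>R. 3 * L\<^sup>2 * \<rho> r \<le> r)}}"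

definition kappa' :: "(real \<Rightarrow> real) \<Rightarrow> real \<Rightarrow> real \<Rightarrow> real" where
  "kappa' \<rho> L A = (L\<^sup>2 + 2) * (2 * kappa \<rho> L A + A)"

definition nbhd :: "real \<Rightarrow> 'a::metric_space set \<Rightarrow> 'a set" where
  "nbhd r Z = {x. \<exists>z\<in>Z. dist x z < r}"

end

theory Submission
  imports Defs
begin

text \<open>
  Let \<open>\<beta>\<close> start at distance \<open>\<kappa>\<close> from \<open>Z\<close> at time \<open>a\<close> and stay at distance at least \<open>\<kappa>\<close>
  until time \<open>b\<close>. Going back from \<open>b\<close>, repeatedly pick an earlier point whose distance from the
  current point \<open>x\<close> is exactly \<open>d(x, Z)\<close>. Since \<open>d(x, Z) \<ge> \<kappa>\<close>, such a step moves the
  projection to \<open>Z\<close> by at most \<open>d(x, Z) / (3 L\<^sup>2)\<close>, which is at most \<open>1 / (2 L)\<close> times the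
  time spent. So the projection advances at no more than half the rate \<open>1 / L\<close> at which
  \<open>\<beta>\<close> must escape. Hence \<open>b - a\<close> is bounded if \<open>\<beta>\<close> comes back at time \<open>b\<close>, and
  \<open>d(\<beta>\<^sub>b, Z)\<close> grows linearly in \<open>b\<close> otherwise.
\<close>

section \<open>Crossing times of a continuous function\<close>

text \<open>The time is the maximum of the compact sublevel set. The intermediate value theorem
  gives the value \<open>k\<close> at or after this maximum, and maximality leaves only the maximum
  itself.\<close>

lemma last_crossing:
  fixes f :: "real \<Rightarrow> real"
  assumes cont: "continuous_on {u..v} f" and "u \<le> v" "f u \<le> k" "k \<le> f v"
  shows "\<exists>a\<in>{u..v}. f a = k \<and> (\<forall>s\<in>{a<..v}. k < f s)"
proof -
  define S where "S = {s \<in> {u..v}. f s \<le> k}"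
  have "closed S"
    unfolding S_def by (rule continuous_on_closed_Collect_le[OF cont]) simp_all
  moreover have "bounded S"
    by (rule bounded_subset[OF bounded_closed_interval[of u v]]) (auto simp: S_def)
  ultimately have "compact S" by (simp add: compact_eq_bounded_closed)
  moreover have "S \<noteq> {}" using assms by (auto simp: S_def)
  ultimately obtain a where a: "a \<in> S" "\<And>s. s \<in> S \<Longrightarrow> s \<le> a"
    using compact_attains_sup[of S] by blast
  then have "u \<le> a" "a \<le> v" "f a \<le> k" by (auto simp: S_def)
  then have "continuous_on {a..v} f"
    by (intro continuous_on_subset[OF cont]) auto
  then obtain x where x: "a \<le> x" "x \<le> v" "f x = k"
    using IVT'[of f a k v] \<open>f a \<le> k\<close> \<open>k \<le> f v\<close> \<open>a \<le> v\<close> by blast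
  then have "x \<in> S" using \<open>u \<le> a\<close> by (simp add: S_def)
  then have "x = a" using a(2) x(1) by force
  moreover have "k < f s" if "s \<in> {a<..v}" for s
    using a(2)[of s] that \<open>u \<le> a\<close> by (force simp: S_def)
  ultimately show ?thesis using x \<open>u \<le> a\<close> by auto
qed

text \<open>This is \<open>last_crossing\<close> with time reversed.\<close>

lemma first_crossing:
  fixes f :: "real \<Rightarrow> real"
  assumes cont: "continuous_on {u..v} f" and "u \<le> v" "k \<le> f u" "f v \<le> k"
  shows "\<exists>b\<in>{u..v}. f b = k \<and> (\<forall>s\<in>{u..<b}. k < f s)"
proof -
  have "continuous_on {-v..-u} (\<lambda>x. f (- x))"
    by (rule continuous_on_compose2[OF cont]) (auto simp: continuous_on_minus)
  then have "\<exists>a\<in>{-v..-u}. f (-a) = k \<and> (\<forall>s\<in>{a<..-u}. k < f (-s))"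
    by (rule last_crossing) (simp_all add: assms)
  then obtain a where a: "a \<in> {-v..-u}" "f (-a) = k" "\<And>s. s \<in> {a<..-u} \<Longrightarrow> k < f (-s)"
    by blast
  have "k < f s" if "s \<in> {u..<-a}" for s
    using a(3)[of "-s"] that by simp
  with a show ?thesis by (intro bexI[of _ "-a"]) auto
qed

section \<open>Projections to \<open>Z\<close> and the threshold \<kappa>\<close>

text \<open>Properness makes the part of \<open>Z\<close> in a closed ball about \<open>x\<close>
  compact, so the distance attains its minimum there; points of \<open>Z\<close> outside the ball
  are farther away.\<close>

lemma closest_points_nonempty:
  fixes Z :: "'a::metric_space set"
  assumes "proper_space TYPE('a)" "closed Z" "Z \<noteq> {}"
  shows "closest_points Z x \<noteq> {}"
proof -
  obtain z0 where z0: "z0 \<in> Z" using assms by auto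
  let ?K = "cball x (dist x z0) \<inter> Z"
  have "compact ?K"
    using assms by (intro compact_Int_closed) (auto simp: proper_space_def)
  moreover have "?K \<noteq> {}" using z0 by auto
  ultimately obtain z where z: "z \<in> ?K" "\<forall>y\<in>?K. dist x z \<le> dist x y"
    using continuous_attains_inf[of ?K "dist x"]
      continuous_on_dist[OF continuous_on_const continuous_on_id, of ?K x] by blast
  have "dist x z \<le> dist x y" if "y \<in> Z" for y
    using z that by (cases "y \<in> ?K") auto
  then have "dist x z \<le> infdist x Z"
    using \<open>Z \<noteq> {}\<close> by (auto simp: infdist_def intro: cINF_greatest)
  then have "dist x z = infdist x Z"
    using z(1) infdist_le[of z Z x] by auto
  with z(1) show ?thesis by (auto simp: closest_points_def)
qed

lemma contracting_dist_le:
  assumes "contracting \<rho> Z" "dist x y \<le> infdist x Z"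
    and "p \<in> closest_points Z x" "q \<in> closest_points Z y"
  shows "dist p q \<le> \<rho> (infdist x Z)"
proof -
  have "bounded (closest_points Z w)" for w
    by (rule bounded_subset[OF bounded_cball[of w "infdist w Z"]])
      (auto simp: closest_points_def)
  then have "bounded (closest_points Z x \<union> closest_points Z y)" by simp
  then have "dist p q \<le> diameter (closest_points Z x \<union> closest_points Z y)"
    using assms(3,4) by (intro diameter_bounded_bound) auto
  with assms(1,2) show ?thesis by (force simp: contracting_def)
qed

lemma kappa_ge: "3 * A \<le> kappa \<rho> L A" "3 * L\<^sup>2 \<le> kappa \<rho> L A"
  by (auto simp: kappa_def)

lemma sublinear_le_of_kappa_le:
  assumes "sublinear \<rho>" "L \<ge> 1" "kappa \<rho> L A \<le> r"
  shows "3 * L\<^sup>2 * \<rho> r \<le> r"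
proof -
  let ?S = "{R. 0 < R \<and> (\<forall>r\<ge>R. 3 * L\<^sup>2 * \<rho> r \<le> r)}"
  have pos: "0 < 3 * L\<^sup>2" using \<open>L \<ge> 1\<close> by simp
  have "((\<lambda>r. \<rho> r / r) \<longlongrightarrow> 0) at_top" using assms(1) by (simp add: sublinear_def)
  then have "eventually (\<lambda>r. \<rho> r / r < 1 / (3 * L\<^sup>2)) at_top"
    using pos by (intro order_tendstoD(2)) auto
  then obtain N where N: "\<And>r. N \<le> r \<Longrightarrow> \<rho> r / r < 1 / (3 * L\<^sup>2)"
    by (auto simp: eventually_at_top_linorder)
  have "3 * L\<^sup>2 * \<rho> r \<le> r" if "max N 1 \<le> r" for r
  proof -
    have "0 < r" "\<rho> r / r < 1 / (3 * L\<^sup>2)" using that N by auto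
    then have "\<rho> r < 1 / (3 * L\<^sup>2) * r" by (simp only: pos_divide_less_eq)
    with pos show ?thesis by (simp add: field_simps)
  qed
  then have "max N 1 \<in> ?S" by auto
  then have "?S \<noteq> {}" by blast
  \<comment> \<open>The infimum may fail to be a member of the set. The summand 1 in
    \<open>kappa\<close> leaves room for a member strictly below \<open>1 + Inf\<close>.\<close>
  then obtain R where R: "R \<in> ?S" "R < 1 + Inf ?S"
    using cInf_lessD[of ?S "1 + Inf ?S"] by auto
  have "1 + Inf ?S \<le> kappa \<rho> L A" by (simp add: kappa_def)
  with R assms(3) show ?thesis by auto
qed

section \<open>Excursions away from \<open>Z\<close>\<close>

text \<open>Here \<kappa> is any number with the listed properties, and \<open>a\<close> is any time
  at which the ray is at distance exactly \<kappa>. That the ray then stays at distance at least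
  \<kappa> is assumed lemma by lemma, up to an end time \<open>b\<close>.\<close>

locale excursion =
  fixes \<rho> :: "real \<Rightarrow> real" and L A \<kappa> :: real
    and Z :: "'a::metric_space set" and \<beta> :: "real \<Rightarrow> 'a" and a :: real
  assumes proper: "proper_space TYPE('a)"
    and nonempty: "Z \<noteq> {}" and contr: "contracting \<rho> Z"
    and L: "1 \<le> L" and A: "0 \<le> A"
    and \<kappa>A: "3 * A \<le> \<kappa>" and \<kappa>L: "3 * L\<^sup>2 \<le> \<kappa>"
    and \<rho>_le: "\<And>r. \<kappa> \<le> r \<Longrightarrow> 3 * L\<^sup>2 * \<rho> r \<le> r"
    and cont: "continuous_on {a..} \<beta>" and qg: "quasi_geodesic_on {a..} L A \<beta>"
    and start: "infdist (\<beta> a) Z = \<kappa>"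
begin

lemma closed: "closed Z"
  using contr by (simp add: contracting_def)

lemma \<kappa>_pos: "0 < \<kappa>"
  using \<kappa>L L by (smt (verit) zero_less_power)

lemma
  assumes "a \<le> s" "s \<le> t"
  shows dist_le: "dist (\<beta> s) (\<beta> t) \<le> L * (t - s) + A"
    and dist_ge: "(t - s) / L - A \<le> dist (\<beta> s) (\<beta> t)"
proof -
  have "\<bar>s - t\<bar> = t - s" using assms by simp
  moreover have "1 / L * \<bar>s - t\<bar> - A \<le> dist (\<beta> s) (\<beta> t) \<and>
      dist (\<beta> s) (\<beta> t) \<le> L * \<bar>s - t\<bar> + A"
    using qg assms unfolding quasi_geodesic_on_def
    by (meson atLeast_iff order_trans)
  ultimately show "dist (\<beta> s) (\<beta> t) \<le> L * (t - s) + A"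
    "(t - s) / L - A \<le> dist (\<beta> s) (\<beta> t)" by simp_all
qed

lemma projection_dist_le:
  assumes "a \<le> b" "\<And>s. a \<le> s \<Longrightarrow> s \<le> b \<Longrightarrow> \<kappa> \<le> infdist (\<beta> s) Z"
    and "p \<in> closest_points Z (\<beta> a)" "q \<in> closest_points Z (\<beta> b)"
  shows "dist p q \<le> (b - a) / (2 * L) + (\<kappa> + A) / (3 * L\<^sup>2)"
proof -
  \<comment> \<open>every step back takes at least time \<open>c\<close>, so \<open>n\<close> counts steps\<close>
  define c where "c = 2 * \<kappa> / (3 * L)"
  have "0 < c" using \<kappa>_pos L by (simp add: c_def)
  obtain n :: nat where "(b - a) / c \<le> real n" using real_arch_simple by blast
  then have "b - a \<le> real n * c" using \<open>0 < c\<close> by (simp add: field_simps)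
  \<comment> \<open>A step back replaces \<open>b\<close> by an earlier time \<open>u\<close> and
    \<open>q\<close> by a projection of the point at time \<open>u\<close>, so both must vary in the
    induction.\<close>
  then show ?thesis using assms
  proof (induction n arbitrary: b q)
    \<comment> \<open>One point can have several projections, so \<open>p\<close> and
      \<open>q\<close> may still differ.\<close>
    case (0 b q)
    then have "b = a" by simp
    have "dist p q \<le> \<rho> (infdist (\<beta> a) Z)"
      by (rule contracting_dist_le[OF contr _ "0.prems"(4,5)])
        (simp add: \<open>b = a\<close> infdist_nonneg)
    then have "dist p q \<le> \<rho> \<kappa>" by (simp add: start)
    moreover have "\<rho> \<kappa> \<le> \<kappa> / (3 * L\<^sup>2)" using \<rho>_le[of \<kappa>] L by (simp add: field_simps)
    moreover have "\<kappa> / (3 * L\<^sup>2) \<le> (\<kappa> + A) / (3 * L\<^sup>2)" using A by (intro divide_right_mono) auto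
    ultimately show ?case using \<open>b = a\<close> by simp
  next
    case (Suc n b q)
    let ?d = "infdist (\<beta> b) Z"
    have "\<kappa> \<le> ?d" using Suc.prems by auto
    then have \<rho>d: "\<rho> ?d \<le> ?d / (3 * L\<^sup>2)"
      using \<rho>_le[of ?d] L by (simp add: field_simps)
    show ?case
    proof (cases "dist (\<beta> a) (\<beta> b) \<le> ?d")
      \<comment> \<open>The starting point is within reach, so one contraction compares
        \<open>q\<close> with \<open>p\<close> directly. This last jump produces the additive term
        \<open>(\<kappa> + A) / (3 * L\<^sup>2)\<close>.\<close>
      case True
      then have "dist p q \<le> \<rho> ?d"
        using contracting_dist_le[OF contr _ Suc.prems(5,4)] by (simp add: dist_commute)
      moreover have "?d \<le> \<kappa> + (L * (b - a) + A)"
        using infdist_triangle[of "\<beta> b" Z "\<beta> a"] dist_le[of a b] start Suc.prems(2)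
        by (simp add: dist_commute)
      then have "?d / (3 * L\<^sup>2) \<le> (\<kappa> + (L * (b - a) + A)) / (3 * L\<^sup>2)"
        by (intro divide_right_mono) auto
      moreover have "\<dots> = (b - a) / (3 * L) + (\<kappa> + A) / (3 * L\<^sup>2)"
        using L by (simp add: field_simps power2_eq_square)
      moreover have "(b - a) / (3 * L) \<le> (b - a) / (2 * L)"
        using L Suc.prems(2) by (intro divide_left_mono) auto
      ultimately show ?thesis using \<rho>d by linarith
    next
      case False
      \<comment> \<open>The distance to the point at time \<open>b\<close> exceeds \<open>?d\<close>
        at time \<open>a\<close> and vanishes at time \<open>b\<close>, hence equals
        \<open>?d\<close> at some time \<open>u\<close> between.\<close>
      have "continuous_on {a..b} (\<lambda>s. dist (\<beta> s) (\<beta> b))"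
        by (intro continuous_intros continuous_on_subset[OF cont]) auto
      then obtain u where u: "a \<le> u" "u \<le> b" "dist (\<beta> u) (\<beta> b) = ?d"
        using IVT2'[of "\<lambda>s. dist (\<beta> s) (\<beta> b)" b ?d a] False Suc.prems(2) infdist_nonneg by auto
      have "?d \<le> L * (b - u) + A" using dist_le[of u b] u by simp
      \<comment> \<open>The additive error \<open>A\<close> is at most \<kappa>/3, hence at most a
        third of \<open>?d\<close>.\<close>
      then have step: "2 * ?d / 3 \<le> L * (b - u)" using \<kappa>A \<open>\<kappa> \<le> ?d\<close> by simp
      have "c \<le> b - u"
      proof -
        have "2 * \<kappa> / 3 \<le> L * (b - u)" using step \<open>\<kappa> \<le> ?d\<close> by simp
        then show ?thesis using L by (simp add: c_def field_simps)
      qed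
      obtain w where w: "w \<in> closest_points Z (\<beta> u)"
        using closest_points_nonempty[OF proper closed nonempty] by blast
      have "dist w q \<le> \<rho> ?d"
        using contracting_dist_le[OF contr _ Suc.prems(5) w] u
        by (simp add: dist_commute)
      also have "\<dots> \<le> ?d / (3 * L\<^sup>2)" by (rule \<rho>d)
      also have "\<dots> \<le> L * (b - u) * (3 / 2) / (3 * L\<^sup>2)"
        using step by (intro divide_right_mono) auto
      also have "\<dots> = (b - u) / (2 * L)"
        using L by (simp add: field_simps power2_eq_square)
      finally have "dist w q \<le> (b - u) / (2 * L)" .
      moreover have "dist p w \<le> (u - a) / (2 * L) + (\<kappa> + A) / (3 * L\<^sup>2)"
      proof (rule Suc.IH)
        show "u - a \<le> real n * c"
          using Suc.prems(1) \<open>c \<le> b - u\<close> by (simp add: algebra_simps)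
      qed (use u w Suc.prems in auto)
      moreover have "(b - u) / (2 * L) + (u - a) / (2 * L) = (b - a) / (2 * L)"
        by (simp add: add_divide_distrib[symmetric])
      ultimately show ?thesis using dist_triangle[of p q w] by linarith
    qed
  qed
qed

text \<open>Compare the lower quasi-geodesic bound with the path through the projections
  \<open>p\<close> and \<open>q\<close>. The motion of the projection uses up half of
  \<open>(b - a) / L\<close>; the other half remains.\<close>

lemma infdist_end_ge:
  assumes "a \<le> b" "\<And>s. a \<le> s \<Longrightarrow> s \<le> b \<Longrightarrow> \<kappa> \<le> infdist (\<beta> s) Z"
  shows "(b - a) / (2 * L) \<le> infdist (\<beta> b) Z + \<kappa> + A + (\<kappa> + A) / (3 * L\<^sup>2)"
proof -
  obtain p q where pq: "p \<in> closest_points Z (\<beta> a)" "q \<in> closest_points Z (\<beta> b)"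
    using closest_points_nonempty[OF proper closed nonempty] by (meson ex_in_conv)
  then have "dist (\<beta> a) p = \<kappa>" "dist (\<beta> b) q = infdist (\<beta> b) Z"
    using start by (auto simp: closest_points_def)
  moreover have "dist (\<beta> a) (\<beta> b) \<le> dist (\<beta> a) p + dist p q + dist (\<beta> b) q"
    by metric
  moreover have "(b - a) / L - A \<le> dist (\<beta> a) (\<beta> b)" using dist_ge assms(1) by simp
  moreover have "(b - a) / L = (b - a) / (2 * L) + (b - a) / (2 * L)" by simp
  moreover have "dist p q \<le> (b - a) / (2 * L) + (\<kappa> + A) / (3 * L\<^sup>2)"
    by (rule projection_dist_le) (use assms pq in auto)
  ultimately show ?thesis by linarith
qed

lemma correction_le: "(\<kappa> + A) / (3 * L\<^sup>2) \<le> (\<kappa> + A) / 3"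
  using L A \<kappa>_pos by (intro divide_left_mono) auto

lemma infdist_escape:
  assumes "a \<le> b" "\<And>s. a \<le> s \<Longrightarrow> s \<le> b \<Longrightarrow> \<kappa> \<le> infdist (\<beta> s) Z"
  shows "1 / (2 * L) * (b - a) - 2 * (A + \<kappa>) \<le> infdist (\<beta> b) Z"
proof -
  have "(b - a) / (2 * L) \<le> infdist (\<beta> b) Z + \<kappa> + A + (\<kappa> + A) / (3 * L\<^sup>2)"
    by (rule infdist_end_ge) (use assms in auto)
  also have "\<dots> \<le> infdist (\<beta> b) Z + 2 * (A + \<kappa>)"
    using correction_le \<kappa>_pos A by argo
  finally show ?thesis by simp
qed

lemma infdist_between_less:
  assumes "a \<le> t" "t \<le> b" "\<And>s. a \<le> s \<Longrightarrow> s \<le> b \<Longrightarrow> \<kappa> \<le> infdist (\<beta> s) Z"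
    and "infdist (\<beta> b) Z = \<kappa>"
  shows "infdist (\<beta> t) Z < (L\<^sup>2 + 2) * (2 * \<kappa> + A)"
proof -
  have "infdist (\<beta> t) Z \<le> \<kappa> + (L * (t - a) + A)"
    using infdist_triangle[of "\<beta> t" Z "\<beta> a"] dist_le[of a t] start assms
    by (simp add: dist_commute)
  moreover have "infdist (\<beta> t) Z \<le> \<kappa> + (L * (b - t) + A)"
    using infdist_triangle[of "\<beta> t" Z "\<beta> b"] dist_le[of t b] assms by simp
  \<comment> \<open>The average of the two bounds, from \<open>a\<close> and from \<open>b\<close>,
    does not involve \<open>t\<close>.\<close>
  ultimately have half: "infdist (\<beta> t) Z \<le> \<kappa> + A + L * (b - a) / 2"
    by (simp add: field_simps)
  have "L * (b - a) / 2 = L\<^sup>2 * ((b - a) / (2 * L))"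
    using L by (simp add: field_simps power2_eq_square)
  \<comment> \<open>Being back at distance \<kappa> at time \<open>b\<close> bounds the length of
    the excursion.\<close>
  also have "\<dots> \<le> L\<^sup>2 * (2 * \<kappa> + A + (\<kappa> + A) / (3 * L\<^sup>2))"
    using infdist_end_ge[of b] assms by (intro mult_left_mono) auto
  also have "\<dots> = L\<^sup>2 * (2 * \<kappa> + A) + (\<kappa> + A) / 3"
    using L by (simp add: field_simps)
  finally have "infdist (\<beta> t) Z \<le> L\<^sup>2 * (2 * \<kappa> + A) + (4 / 3) * (\<kappa> + A)"
    using half by argo
  also have "\<dots> < L\<^sup>2 * (2 * \<kappa> + A) + 2 * (2 * \<kappa> + A)"
    using \<kappa>_pos A by simp
  finally show ?thesis by (simp add: algebra_simps)
qed

end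

section \<open>The two alternatives\<close>

theorem corollary4p3:
  fixes \<rho> :: "real \<Rightarrow> real" and L A :: real
    and Z :: "'a::metric_space set" and \<beta> :: "real \<Rightarrow> 'a"
  assumes "proper_space TYPE('a)" and "geodesic_space TYPE('a)"
    and "sublinear \<rho>" and "L \<ge> 1" and "A \<ge> 0"
    and "Z \<noteq> {}" and "contracting \<rho> Z"
    and "continuous_on {0..} \<beta>" and "quasi_geodesic_on {0..} L A \<beta>"
    and "infdist (\<beta> 0) Z \<le> kappa \<rho> L A"
  shows
    "(\<not> bounded {t. 0 \<le> t \<and> infdist (\<beta> t) Z \<le> kappa \<rho> L A} \<and>
      \<beta> ` {0..} \<subseteq> nbhd (kappa' \<rho> L A) Z)
     \<or>
     (\<exists>T0\<ge>0. infdist (\<beta> T0) Z = kappa \<rho> L A \<and>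
        (\<forall>t>T0. infdist (\<beta> t) Z \<noteq> kappa \<rho> L A) \<and>
        (\<forall>t\<ge>0. infdist (\<beta> t) Z \<ge> 1 / (2 * L) * (t - T0) - 2 * (A + kappa \<rho> L A)))"
proof -
  define \<kappa> where "\<kappa> = kappa \<rho> L A"
  define f where "f t = infdist (\<beta> t) Z" for t
  let ?S = "{t. 0 \<le> t \<and> infdist (\<beta> t) Z \<le> \<kappa>}"
  have f0: "f 0 \<le> \<kappa>" using assms by (simp add: f_def \<kappa>_def)
  have contf: "continuous_on {u..v} f" if "0 \<le> u" for u v
    unfolding f_def using that
    by (intro continuous_on_infdist continuous_on_subset[OF assms(8)]) auto
  have exc: "excursion \<rho> L A \<kappa> Z \<beta> a" if "0 \<le> a" "f a = \<kappa>" for a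
  proof
    show "quasi_geodesic_on {a..} L A \<beta>"
      using assms(9) that(1) by (auto simp: quasi_geodesic_on_def is_interval_ci)
    show "continuous_on {a..} \<beta>"
      using that by (intro continuous_on_subset[OF assms(8)]) auto
    show "infdist (\<beta> a) Z = \<kappa>" using that by (simp add: f_def)
    show "3 * L\<^sup>2 * \<rho> r \<le> r" if "\<kappa> \<le> r" for r
      using sublinear_le_of_kappa_le assms(3,4) that by (simp add: \<kappa>_def)
  qed (use assms kappa_ge in \<open>auto simp: \<kappa>_def\<close>)
  show ?thesis
  proof (cases "bounded ?S")
    case True
    then obtain B where B: "\<And>t. t \<in> ?S \<Longrightarrow> \<bar>t\<bar> \<le> B" by (auto simp: bounded_iff)
    have "0 \<le> B" using B[of 0] f0 by (simp add: f_def)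
    have far: "\<kappa> < f t" if "B < t" for t
      using B[of t] that \<open>0 \<le> B\<close> by (force simp: f_def)
    \<comment> \<open>All times in \<open>?S\<close> are at most \<open>B\<close>, so
      \<open>B + 1\<close> is a time beyond the threshold and the last crossing before it is the
      last one of all.\<close>
    have "\<exists>T\<in>{0..B + 1}. f T = \<kappa> \<and> (\<forall>s\<in>{T<..B + 1}. \<kappa> < f s)"
      by (rule last_crossing) (use contf f0 far[of "B + 1"] \<open>0 \<le> B\<close> in auto)
    then obtain T where T: "0 \<le> T" "f T = \<kappa>" "\<forall>s\<in>{T<..B + 1}. \<kappa> < f s"
      by auto
    have after: "\<kappa> < f t" if "T < t" for t
      using far[of t] T(3) that by (cases "B < t") auto
    interpret excursion \<rho> L A \<kappa> Z \<beta> T using exc T by blast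
    have "1 / (2 * L) * (t - T) - 2 * (A + \<kappa>) \<le> f t" if "0 \<le> t" for t
    proof (cases "T \<le> t")
      case True
      have "\<kappa> \<le> infdist (\<beta> s) Z" if "T \<le> s" for s
        using after[of s] T(2) that by (cases "s = T") (auto simp: f_def)
      then show ?thesis using infdist_escape[OF True] by (simp add: f_def)
    next
      case False
      \<comment> \<open>Before \<open>T\<close> the claimed lower bound is negative.\<close>
      then have "1 / (2 * L) * (t - T) \<le> 0" using L by (intro mult_nonneg_nonpos) auto
      also have "0 \<le> 2 * (A + \<kappa>) + f t"
        using A \<kappa>_pos by (simp add: f_def infdist_nonneg)
      finally show ?thesis by simp
    qed
    then show ?thesis
      using T after by (intro disjI2 exI[of _ T]) (force simp: f_def \<kappa>_def)
  next
    case False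
    have less: "f t < kappa' \<rho> L A" if "0 \<le> t" for t
    proof -
      have "\<exists>s>t. f s \<le> \<kappa>"
      proof (rule ccontr)
        assume "\<not> ?thesis"
        then have "?S \<subseteq> {0..t}" by (force simp: f_def)
        with False show False using bounded_subset bounded_closed_interval by blast
      qed
      then obtain s where s: "t < s" "f s \<le> \<kappa>" by blast
      have pos: "0 < \<kappa>" using kappa_ge(2)[of L \<rho> A] assms(4)
        by (smt (verit) \<kappa>_def zero_less_power)
      show ?thesis
      proof (cases "f t \<le> \<kappa>")
        case True
        \<comment> \<open>Near \<open>Z\<close> it is enough that \<kappa> is smaller than
          \<open>kappa'\<close>.\<close>
        have "0 \<le> L\<^sup>2 * (2 * \<kappa> + A)" using assms(5) pos by simp
        then have "\<kappa> < L\<^sup>2 * (2 * \<kappa> + A) + 2 * (2 * \<kappa> + A)"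
          using assms(5) pos by argo
        also have "\<dots> = (L\<^sup>2 + 2) * (2 * \<kappa> + A)" by (simp only: distrib_right)
        finally have "\<kappa> < (L\<^sup>2 + 2) * (2 * \<kappa> + A)" .
        with True show ?thesis by (simp add: kappa'_def \<kappa>_def)
      next
        case gt: False
        \<comment> \<open>The last crossing before \<open>t\<close> and the first one after it bound
          the excursion that contains \<open>t\<close>.\<close>
        have "\<exists>a\<in>{0..t}. f a = \<kappa> \<and> (\<forall>r\<in>{a<..t}. \<kappa> < f r)"
          by (rule last_crossing) (use contf f0 that gt in auto)
        then obtain a where a: "0 \<le> a" "a \<le> t" "f a = \<kappa>" "\<forall>r\<in>{a<..t}. \<kappa> < f r"
          by auto
        have "\<exists>b\<in>{t..s}. f b = \<kappa> \<and> (\<forall>r\<in>{t..<b}. \<kappa> < f r)"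
          by (rule first_crossing) (use contf s that gt in auto)
        then obtain b where b: "t \<le> b" "f b = \<kappa>" "\<forall>r\<in>{t..<b}. \<kappa> < f r"
          by auto
        have "\<kappa> \<le> f r" if "a \<le> r" "r \<le> b" for r
          using a b that by (cases "r = a \<or> r = b"; cases "r \<le> t") (auto intro: less_imp_le)
        then have "f t < (L\<^sup>2 + 2) * (2 * \<kappa> + A)"
          using excursion.infdist_between_less[OF exc[OF a(1,3)] a(2) b(1)] b(2)
          unfolding f_def by blast
        then show ?thesis by (simp add: kappa'_def \<kappa>_def)
      qed
    qed
    have "\<beta> t \<in> nbhd (kappa' \<rho> L A) Z" if "0 \<le> t" for t
    proof -
      have "closed Z" using assms(7) by (simp add: contracting_def)
      then obtain z where "z \<in> closest_points Z (\<beta> t)"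
        using closest_points_nonempty[OF assms(1) _ assms(6)] by blast
      with less[OF that] show ?thesis by (force simp: nbhd_def closest_points_def f_def)
    qed
    with False show ?thesis by (auto simp: \<kappa>_def)
  qed
qed

end
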